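(* Let $n,k\ge 2$ with $k$ even, and let $G$ be a linear $k$-uniform hypergraph with vertex set $[n]$ and at least one edge. Let $c_{\max}$ be the largest component among all least eigenvectors of $G$, and let $\mathbf{x}$ be a least eigenvector of $G$ and $i\in[n]$ a vertex with $x_i=c_{\max}$. Then $$c_{\max}\le \sqrt[k]{\frac{n-1}{n-1+(k-1)^2}},$$ with equality if and only if all of the following hold: for every $j\in[n]\setminus\{i\}$, $x_j^k=\dfrac{x_i^k}{\left(\frac{n-1}{k-1}\right)^{\frac{k}{k-1}}}$ if $j\sim i$ and $x_j=0$ otherwise; $\lambda(G)=-1$; the maximum degree of $G$ is $\frac{n-1}{k-1}$; and the sign of $\mathbf{x}^{e\setminus\{i\}}$ is the same for all $e\in E_i(G)$.
   Context: $[n]=\{1,\dots,n\}$. A $k$-uniform hypergraph $G$ has vertex set $V(G)$ and edge set $E(G)$ consisting of $k$-element subsets of $V(G)$; it is linear if every two distinct edges intersect in at most one vertex. $E_i(G)$ is the set of edges containing $i$, and the degree of $i$ is $|E_i(G)|$. For distinct vertices, $j\sim i$ means some edge contains both. The adjacency tensor $\mathcal{A}(G)=(a_{i_1\dots i_k})$ has order $k$ and dimension $|V(G)|$, with $a_{i_1\dots i_k}=\frac{1}{(k-1)!}$ if $\{i_1,\dots,i_k\}\in E(G)$ and $0$ otherwise. For a vector $\mathbf{x}$ indexed by $V(G)$ and $U\subseteq V(G)$, $\mathbf{x}^U=\prod_{w\in U}x_w$. A real number $\lambda$ is an H-eigenvalue of $\mathcal{A}(G)$ with H-eigenvector $\mathbf{x}$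 (a nonzero real vector) if $\lambda x_u^{k-1}=\sum_{e\in E_u(G)}\mathbf{x}^{e\setminus\{u\}}$ for all $u\in V(G)$. $\lambda(G)$ denotes the least H-eigenvalue of $\mathcal{A}(G)$. A least eigenvector of $G$ is a real vector $\mathbf{x}$ with $\sum_i|x_i|^k=1$ that is an eigenvector of $\mathcal{A}(G)$ associated with $\lambda(G)$. *)

theory Defs
  imports Complex_Main "HOL-Combinatorics.Multiset_Permutations"
begin

definition uniform_hypergraph :: "nat \<Rightarrow> 'a set \<Rightarrow> 'a set set \<Rightarrow> bool" where
  "uniform_hypergraph k V E \<longleftrightarrow> finite V \<and> (\<forall>e\<in>E. e \<subseteq> V \<and> card e = k)"

definition linear_hypergraph :: "'a set set \<Rightarrow> bool" where
  "linear_hypergraph E \<longleftrightarrow> (\<forall>e\<in>E. \<forall>f\<in>E. e \<noteq> f \<longrightarrow> card (e \<inter> f) \<le> 1)"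

definition edges_at :: "'a set set \<Rightarrow> 'a \<Rightarrow> 'a set set" where
  "edges_at E i = {e \<in> E. i \<in> e}"

definition vertex_degree :: "'a set set \<Rightarrow> 'a \<Rightarrow> nat" where
  "vertex_degree E i = card (edges_at E i)"

definition max_degree :: "'a set \<Rightarrow> 'a set set \<Rightarrow> nat" where
  "max_degree V E = Max (vertex_degree E ` V)"

definition adjacent :: "'a set set \<Rightarrow> 'a \<Rightarrow> 'a \<Rightarrow> bool" where
  "adjacent E j i \<longleftrightarrow> j \<noteq> i \<and> (\<exists>e\<in>E. j \<in> e \<and> i \<in> e)"

text \<open>
  A vector indexed by \<open>V\<close> is a function of type \<open>'a \<Rightarrow> real\<close>; all notions below depend only on
  its values on \<open>V\<close>. The monomial \<open>x\<^sup>U\<close> is \<open>\<Prod>w\<in>U. x w\<close>.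
\<close>

definition H_eigenpair ::
  "nat \<Rightarrow> 'a set \<Rightarrow> 'a set set \<Rightarrow> real \<Rightarrow> ('a \<Rightarrow> real) \<Rightarrow> bool" where
  "H_eigenpair k V E \<mu> x \<longleftrightarrow>
     (\<exists>u\<in>V. x u \<noteq> 0) \<and>
     (\<forall>u\<in>V. \<mu> * x u ^ (k - 1) = (\<Sum>e\<in>edges_at E u. \<Prod>w\<in>e - {u}. x w))"

definition H_eigenvalue :: "nat \<Rightarrow> 'a set \<Rightarrow> 'a set set \<Rightarrow> real \<Rightarrow> bool" where
  "H_eigenvalue k V E \<mu> \<longleftrightarrow> (\<exists>x. H_eigenpair k V E \<mu> x)"

definition least_H_eigenvalue :: "nat \<Rightarrow> 'a set \<Rightarrow> 'a set set \<Rightarrow> real" where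
  "least_H_eigenvalue k V E = (LEAST \<mu>. H_eigenvalue k V E \<mu>)"

definition least_eigenvector :: "nat \<Rightarrow> 'a set \<Rightarrow> 'a set set \<Rightarrow> ('a \<Rightarrow> real) \<Rightarrow> bool" where
  "least_eigenvector k V E x \<longleftrightarrow>
     H_eigenpair k V E (least_H_eigenvalue k V E) x \<and> (\<Sum>v\<in>V. \<bar>x v\<bar> ^ k) = 1"

definition c_max :: "nat \<Rightarrow> 'a set \<Rightarrow> 'a set set \<Rightarrow> real" where
  "c_max k V E = (GREATEST c. \<exists>x v. least_eigenvector k V E x \<and> v \<in> V \<and> c = x v)"

text \<open>
  The equations in \<open>H_eigenpair\<close> are the eigenvalue equations of the adjacency tensor. A tensor
  of order \<open>k\<close> and dimension \<open>card V\<close> is given by its entries at the index lists of length \<open>k\<close>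
  over \<open>V\<close>.
\<close>

definition adjacency_tensor :: "nat \<Rightarrow> 'a set set \<Rightarrow> 'a list \<Rightarrow> real" where
  "adjacency_tensor k E is = (if set is \<in> E then 1 / fact (k - 1) else 0)"

definition tensor_apply ::
  "nat \<Rightarrow> 'a set \<Rightarrow> ('a list \<Rightarrow> real) \<Rightarrow> ('a \<Rightarrow> real) \<Rightarrow> 'a \<Rightarrow> real" where
  "tensor_apply k V A x u =
     (\<Sum>is | set is \<subseteq> V \<and> length is = k - 1. A (u # is) * prod_list (map x is))"

lemma tensor_apply_adjacency_tensor:
  assumes G: "uniform_hypergraph k V E" and k: "k \<ge> 1" and u: "u \<in> V"
  shows "tensor_apply k V (adjacency_tensor k E) x u =
    (\<Sum>e\<in>edges_at E u. \<Prod>w\<in>e - {u}. x w)"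
proof -
  let ?L = "{is. set is \<subseteq> V \<and> length is = k - 1}"
  let ?M = "{is \<in> ?L. insert u (set is) \<in> E}"
  let ?P = "\<lambda>e. permutations_of_set (e - {u})"
  have finV: "finite V" and E: "\<And>e. e \<in> E \<Longrightarrow> e \<subseteq> V \<and> card e = k"
    using G by (auto simp: uniform_hypergraph_def)
  have finL: "finite ?L" using finV by (rule finite_lists_length_eq)
  have "E \<subseteq> Pow V" using E by auto
  hence finE: "finite (edges_at E u)"
    using finV by (auto simp: edges_at_def intro: finite_subset)
  have M: "?M = (\<Union>e\<in>edges_at E u. ?P e)"
  proof (intro equalityI subsetI)
    fix xs assume xs: "xs \<in> ?M"
    let ?e = "insert u (set xs)"
    have c: "card ?e = k" and l: "length xs = k - 1" using xs E by auto
    have "card (set xs) \<le> k - 1" using card_length[of xs] l by simp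
    hence nu: "u \<notin> set xs" using c k by (cases "u \<in> set xs") (auto simp: insert_absorb)
    hence "card (set xs) = length xs" using c l by simp
    hence "distinct xs" by (rule card_distinct)
    moreover have "?e \<in> edges_at E u" using xs by (auto simp: edges_at_def)
    ultimately show "xs \<in> (\<Union>e\<in>edges_at E u. ?P e)"
      using nu by (intro UN_I[of ?e]) (auto simp: permutations_of_set_def)
  next
    fix xs assume "xs \<in> (\<Union>e\<in>edges_at E u. ?P e)"
    then obtain e where e: "e \<in> E" "u \<in> e" "set xs = e - {u}" "distinct xs"
      by (auto simp: edges_at_def permutations_of_set_def)
    have "length xs = card (e - {u})" using e distinct_card by metis
    also have "\<dots> = k - 1" using e E by simp
    finally show "xs \<in> ?M" using e E by (auto simp: insert_absorb)
  qed
  have "tensor_apply k V (adjacency_tensor k E) x u =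
      (\<Sum>is\<in>?M. 1 / fact (k - 1) * prod_list (map x is))"
    unfolding tensor_apply_def adjacency_tensor_def
    using finL by (intro sum.mono_neutral_cong_right) auto
  also have "\<dots> = (\<Sum>e\<in>edges_at E u. \<Sum>is\<in>?P e. 1 / fact (k - 1) * prod_list (map x is))"
    unfolding M
  proof (rule sum.UNION_disjoint[OF finE])
    show "\<forall>e\<in>edges_at E u. finite (?P e)" by simp
    show "\<forall>e\<in>edges_at E u. \<forall>f\<in>edges_at E u. e \<noteq> f \<longrightarrow> ?P e \<inter> ?P f = {}"
      by (auto simp: edges_at_def permutations_of_set_def)
  qed
  also have "\<dots> = (\<Sum>e\<in>edges_at E u. \<Prod>w\<in>e - {u}. x w)"
  proof (rule sum.cong[OF refl])
    fix e assume "e \<in> edges_at E u"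
    hence e: "e \<in> E" "u \<in> e" by (auto simp: edges_at_def)
    have fe: "finite (e - {u})" using e E finV by (meson finite_Diff finite_subset)
    have ce: "card (e - {u}) = k - 1" using e E by simp
    have "(\<Sum>is\<in>?P e. 1 / fact (k - 1) * prod_list (map x is)) =
        (\<Sum>is\<in>?P e. 1 / fact (k - 1) * (\<Prod>w\<in>e - {u}. x w))"
      by (intro sum.cong refl)
         (metis permutations_of_setD prod.distinct_set_conv_list)
    also have "\<dots> = (\<Prod>w\<in>e - {u}. x w)" using fe ce by simp
    finally show "(\<Sum>is\<in>?P e. 1 / fact (k - 1) * prod_list (map x is)) =
        (\<Prod>w\<in>e - {u}. x w)" .
  qed
  finally show ?thesis .
qed

lemma H_eigenpair_iff_tensor:
  assumes "uniform_hypergraph k V E" "k \<ge> 1"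
  shows "H_eigenpair k V E \<mu> x \<longleftrightarrow>
    (\<exists>u\<in>V. x u \<noteq> 0) \<and>
    (\<forall>u\<in>V. tensor_apply k V (adjacency_tensor k E) x u = \<mu> * x u ^ (k - 1))"
  using tensor_apply_adjacency_tensor[OF assms] unfolding H_eigenpair_def by auto

end

theory Submission
  imports Defs "HOL-Analysis.Function_Topology"
begin

text \<open>
  Let \<open>c > 0\<close> be the value of the least eigenvector \<open>x\<close> at \<open>i\<close>, let
  \<open>N = (n - 1) / (k - 1)\<close> and \<open>q = N powr (1 / (k - 1))\<close>. Linearity makes the sets
  \<open>e - {i}\<close>, for edges \<open>e\<close> at \<open>i\<close>, disjoint subsets of size \<open>k - 1\<close> of the other
  \<open>n - 1\<close> vertices, so at most \<open>N\<close> edges meet \<open>i\<close>. As \<open>\<lambda>(G) \<le> -1\<close> (give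
  one vertex of one edge the value \<open>-1\<close> and its other vertices \<open>1\<close>), the eigenvalue equation at
  \<open>i\<close> yields \<open>c ^ (k - 1) \<le> (\<Sum>e. \<bar>\<Prod>w\<in>e - {i}. x w\<bar>)\<close>. Apply the inequality of
  arithmetic and geometric means to each product together with one further factor \<open>t\<close>. The norm
  condition leaves \<open>1 - c ^ k\<close> for the remaining vertices, and the choice \<open>t = c / q\<close> gives
  \<open>c ^ k * (1 + (k - 1) / q) \<le> 1\<close> (\<open>star_inequality\<close>). The claimed bound is the
  weaker inequality \<open>c ^ k * (1 + (k - 1) / N) \<le> 1\<close>, weaker because \<open>q \<le> N\<close>.

  If the bound is attained, so is the stronger inequality, and every estimate in its proof is an
  equality; this is the list of conditions in the theorem. Conversely, the conditions and the
  eigenvalue equation force degree \<open>N\<close> at \<open>i\<close>, and summing the \<open>k\<close>-th powers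
  gives \<open>c ^ k * (1 + (k - 1) / q) = 1\<close>. It remains to see that \<open>q = N\<close>, that is,
  \<open>k = 2\<close> or \<open>N = 1\<close>. Indeed, for \<open>k > 2\<close> a vertex on two edges forces
  \<open>\<lambda>(G) < -1\<close>: a third edge can meet the union of these two in at most two vertices, so
  the union spans no further edge, and the value \<open>-1\<close> at the common vertex and \<open>1\<close> at the
  others is a good test vector (\<open>least_ev_less_if_two_edges_at_vertex\<close>).

  All of this uses that for even \<open>k\<close> the least H-eigenvalue is the minimum of
  \<open>k * (\<Sum>e\<in>E. \<Prod>w\<in>e. x w)\<close> on the unit sphere of the \<open>k\<close>-norm
  (\<open>least_ev_variational\<close>). Compactness also shows that \<open>c_max\<close> is attained, and hence
  positive, since the negative of a least eigenvector is again one.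
\<close>

section \<open>An inequality of arithmetic and geometric means\<close>

lemma le_exp_minus_one: "(x::real) \<le> exp (x - 1)"
  using exp_ge_add_one_self[of "x - 1"] by simp

lemma less_exp_minus_one: "(x::real) \<noteq> 1 \<Longrightarrow> x < exp (x - 1)"
  using le_exp_minus_one[of x] exp_gt_zero[of "x - 1"] ln_eq_minus_one[of x]
  by (metis ln_exp order_le_less)

text \<open>
  This is the inequality of arithmetic and geometric means for the \<open>k\<close> numbers \<open>z w ^ k\<close>
  and \<open>1\<close>. Divided by their mean \<open>M\<close> they have average \<open>1\<close>; multiplying the
  estimates \<open>y \<le> exp (y - 1)\<close> bounds the product of the quotients by \<open>exp 0\<close>. As that
  estimate is strict unless \<open>y = 1\<close>, equality forces all numbers to be \<open>M\<close>, which is then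
  \<open>1\<close>. Unlike its logarithmic form, this estimate also covers zeros among the \<open>z w\<close>.
\<close>

lemma prod_le_mean_power:
  fixes z :: "'b \<Rightarrow> real"
  assumes fin: "finite A" and z: "\<And>w. w \<in> A \<Longrightarrow> 0 \<le> z w" and k: "k = card A + 1"
  shows "real k * (\<Prod>w\<in>A. z w) \<le> (\<Sum>w\<in>A. z w ^ k) + 1"
    and "real k * (\<Prod>w\<in>A. z w) = (\<Sum>w\<in>A. z w ^ k) + 1 \<Longrightarrow> w \<in> A \<Longrightarrow> z w = 1"
proof -
  define M where "M = ((\<Sum>w\<in>A. z w ^ k) + 1) / real k"
  have S0: "(\<Sum>w\<in>A. z w ^ k) \<ge> 0" using z by (intro sum_nonneg) auto
  have M0: "M > 0" unfolding M_def using S0 k by (intro divide_pos_pos) auto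
  let ?R = "(\<Prod>w\<in>A. exp (z w ^ k / M - 1)) * exp (1 / M - 1)"
  have R: "?R = 1"
  proof -
    have "?R = exp ((\<Sum>w\<in>A. z w ^ k / M - 1) + (1 / M - 1))"
      using fin by (simp add: exp_sum exp_add)
    also have "(\<Sum>w\<in>A. z w ^ k / M - 1) + (1 / M - 1) = ((\<Sum>w\<in>A. z w ^ k) + 1) / M - real k"
      by (simp add: sum_subtractf sum_divide_distrib k add_divide_distrib)
    also have "\<dots> = 0" unfolding M_def using S0 k by (simp add: field_simps)
    finally show ?thesis by simp
  qed
  have L: "(\<Prod>w\<in>A. z w ^ k / M) * (1 / M) = ((\<Prod>w\<in>A. z w) / M) ^ k"
    using prod_power_distrib[of z A k] by (simp add: prod_dividef power_divide k)
  have le1: "(\<Prod>w\<in>A. z w ^ k / M) \<le> (\<Prod>w\<in>A. exp (z w ^ k / M - 1))"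
    using z M0 by (intro prod_mono) (auto simp: le_exp_minus_one)
  have pos: "(\<Prod>w\<in>A. exp (z w ^ k / M - 1)) > 0" by (intro prod_pos) auto
  have "(\<Prod>w\<in>A. z w ^ k / M) * (1 / M) \<le> ?R"
    using le1 M0 by (intro mult_mono le_exp_minus_one) (auto intro: less_imp_le[OF pos])
  then have le: "((\<Prod>w\<in>A. z w) / M) ^ k \<le> 1"
    using L R by linarith
  have P0: "(\<Prod>w\<in>A. z w) / M \<ge> 0" using z M0 by (intro divide_nonneg_pos prod_nonneg) auto
  have "(\<Prod>w\<in>A. z w) / M \<le> 1"
    using le P0 k power_le_one_iff[of "(\<Prod>w\<in>A. z w) / M" k] by linarith
  then have "(\<Prod>w\<in>A. z w) \<le> M" using M0 by simp
  then show "real k * (\<Prod>w\<in>A. z w) \<le> (\<Sum>w\<in>A. z w ^ k) + 1"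
    unfolding M_def using k by (simp add: field_simps)
  assume eq: "real k * (\<Prod>w\<in>A. z w) = (\<Sum>w\<in>A. z w ^ k) + 1" and w: "w \<in> A"
  have "(\<Prod>w\<in>A. z w) = M" unfolding M_def using eq k by (simp add: field_simps)
  then have one: "(\<Prod>w\<in>A. z w ^ k / M) * (1 / M) = 1" unfolding L using M0 by simp
  have M1: "M = 1"
  proof (rule ccontr)
    assume "M \<noteq> 1"
    then have "1 / M < exp (1 / M - 1)" using M0 by (intro less_exp_minus_one) auto
    moreover have Ppos: "(\<Prod>w\<in>A. z w ^ k / M) > 0"
      using one M0 by (simp add: zero_less_mult_iff field_simps)
    ultimately have "(\<Prod>w\<in>A. z w ^ k / M) * (1 / M) < (\<Prod>w\<in>A. z w ^ k / M) * exp (1 / M - 1)"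
      by (intro mult_strict_left_mono)
    also have "\<dots> \<le> ?R" using le1 by (intro mult_right_mono) auto
    finally have "(\<Prod>w\<in>A. z w ^ k / M) * (1 / M) < ?R" .
    then show False using one R by simp
  qed
  have "z w ^ k = 1"
  proof (rule ccontr)
    assume "z w ^ k \<noteq> 1"
    then have "(\<Prod>w\<in>A. z w ^ k / M) < (\<Prod>w\<in>A. exp (z w ^ k / M - 1))"
      using fin w z M1 by (intro prod_mono_strict[of w]) (auto simp: le_exp_minus_one less_exp_minus_one)
    then show False using one R M1 by simp
  qed
  then show "z w = 1" using z[OF w] k power_eq_iff_eq_base[of k "z w" 1] by simp
qed

text \<open>The previous inequality for the ratios \<open>y w / t\<close>, scaled by \<open>t ^ k\<close>.\<close>

lemma amgm_with_parameter:
  fixes y :: "'b \<Rightarrow> real"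
  assumes fin: "finite A" and y: "\<And>w. w \<in> A \<Longrightarrow> 0 \<le> y w" and k: "k = card A + 1" and t: "t > 0"
  shows "real k * t * (\<Prod>w\<in>A. y w) \<le> (\<Sum>w\<in>A. y w ^ k) + t ^ k"
    and "real k * t * (\<Prod>w\<in>A. y w) = (\<Sum>w\<in>A. y w ^ k) + t ^ k \<Longrightarrow> w \<in> A \<Longrightarrow> y w = t"
proof -
  have z: "\<And>w. w \<in> A \<Longrightarrow> 0 \<le> y w / t" using y t by simp
  have P: "real k * t * (\<Prod>w\<in>A. y w) = t ^ k * (real k * (\<Prod>w\<in>A. y w / t))"
    using t by (simp add: prod_dividef k)
  have S: "(\<Sum>w\<in>A. y w ^ k) + t ^ k = t ^ k * ((\<Sum>w\<in>A. (y w / t) ^ k) + 1)"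
    using t by (simp add: power_divide sum_divide_distrib[symmetric] distrib_left)
  show "real k * t * (\<Prod>w\<in>A. y w) \<le> (\<Sum>w\<in>A. y w ^ k) + t ^ k"
    unfolding P S using t prod_le_mean_power(1)[OF fin z k] by (intro mult_left_mono) auto
  assume "real k * t * (\<Prod>w\<in>A. y w) = (\<Sum>w\<in>A. y w ^ k) + t ^ k" and w: "w \<in> A"
  then have "real k * (\<Prod>w\<in>A. y w / t) = (\<Sum>w\<in>A. (y w / t) ^ k) + 1"
    unfolding P S using t by simp
  from prod_le_mean_power(2)[OF fin z k this w] show "y w = t" using t by simp
qed

section \<open>The variational description of the least eigenvalue\<close>

text \<open>
  Multiplied by \<open>k\<close>, this is the form \<open>\<A> x ^ k\<close> of the adjacency tensor \<open>\<A>\<close>.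
\<close>

definition edge_form :: "'a set set \<Rightarrow> ('a \<Rightarrow> real) \<Rightarrow> real" where
  "edge_form E x = (\<Sum>e\<in>E. \<Prod>w\<in>e. x w)"

locale even_uniform_hypergraph =
  fixes k :: nat and V :: "'a set" and E :: "'a set set"
  assumes uniform: "uniform_hypergraph k V E"
    and even_k: "even k" and k_ge_2: "k \<ge> 2" and E_nonempty: "E \<noteq> {}"
begin

lemma finite_V: "finite V" and edge_subset: "e \<in> E \<Longrightarrow> e \<subseteq> V" and card_edge: "e \<in> E \<Longrightarrow> card e = k"
  using uniform by (auto simp: uniform_hypergraph_def)

lemma finite_edge: "e \<in> E \<Longrightarrow> finite e"
  using edge_subset finite_V finite_subset by blast

lemma finite_E: "finite E"
proof -
  have "E \<subseteq> Pow V" using edge_subset by auto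
  then show ?thesis using finite_V by (auto intro: finite_subset)
qed

lemma finite_edges_at: "finite (edges_at E u)"
  using finite_E by (auto simp: edges_at_def)

lemma V_nonempty: "V \<noteq> {}"
  using E_nonempty edge_subset card_edge k_ge_2 by fastforce

lemma abs_power_k: "\<bar>a\<bar> ^ k = (a::real) ^ k"
  using even_k by (simp add: power_even_abs)

lemma power_k_nonneg: "(a::real) ^ k \<ge> 0"
  using even_k by (simp add: zero_le_even_power)

lemma sum_edges_at_eq_edge_form:
  "(\<Sum>u\<in>V. x u * (\<Sum>e\<in>edges_at E u. \<Prod>w\<in>e - {u}. x w)) = real k * edge_form E x"
proof -
  have "(\<Sum>u\<in>V. x u * (\<Sum>e\<in>edges_at E u. \<Prod>w\<in>e - {u}. x w)) =
      (\<Sum>u\<in>V. \<Sum>e\<in>{e\<in>E. u \<in> e}. \<Prod>w\<in>e. x w)"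
    unfolding sum_distrib_left edges_at_def
    by (intro sum.cong refl) (auto simp: finite_edge prod.remove)
  also have "\<dots> = (\<Sum>e\<in>E. \<Sum>u\<in>{u\<in>V. u \<in> e}. \<Prod>w\<in>e. x w)"
    using finite_V finite_E by (rule sum.swap_restrict)
  also have "\<dots> = (\<Sum>e\<in>E. real k * (\<Prod>w\<in>e. x w))"
  proof (intro sum.cong refl)
    fix e assume e: "e \<in> E"
    then have "{u\<in>V. u \<in> e} = e" using edge_subset by auto
    then show "(\<Sum>u\<in>{u\<in>V. u \<in> e}. \<Prod>w\<in>e. x w) = real k * (\<Prod>w\<in>e. x w)"
      using card_edge[OF e] by simp
  qed
  finally show ?thesis by (simp add: edge_form_def sum_distrib_left)
qed

text \<open>
  Multiply the eigenvalue equation at \<open>u\<close> by \<open>x u\<close> and sum over \<open>u\<close>; each edge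
  then occurs once for each of its \<open>k\<close> vertices.
\<close>

lemma eigenpair_rayleigh:
  assumes "H_eigenpair k V E \<mu> x"
  shows "\<mu> * (\<Sum>v\<in>V. x v ^ k) = real k * edge_form E x"
proof -
  have "\<mu> * (\<Sum>v\<in>V. x v ^ k) = (\<Sum>u\<in>V. x u * (\<mu> * x u ^ (k - 1)))"
    unfolding sum_distrib_left using k_ge_2
    by (intro sum.cong refl) (simp add: power_eq_if)
  also have "\<dots> = real k * edge_form E x"
    unfolding sum_edges_at_eq_edge_form[symmetric]
    using assms by (intro sum.cong refl) (simp add: H_eigenpair_def)
  finally show ?thesis .
qed

text \<open>
  Eigenvectors may take any values outside \<open>V\<close>. Requiring zeros there makes the sphere a subset
  of a product of compact intervals.
\<close>

definition unit_sphere :: "('a \<Rightarrow> real) set" where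
  "unit_sphere = {x. (\<forall>v. v \<notin> V \<longrightarrow> x v = 0) \<and> (\<Sum>v\<in>V. x v ^ k) = 1}"

lemma unit_sphere_abs_le_1:
  assumes "(\<Sum>v\<in>V. x v ^ k) = 1" "v \<in> V" shows "\<bar>x v\<bar> \<le> (1::real)"
proof -
  have "\<bar>x v\<bar> ^ k \<le> (\<Sum>v\<in>V. x v ^ k)"
    unfolding abs_power_k using assms finite_V power_k_nonneg by (intro member_le_sum) auto
  then show ?thesis using assms(1) k_ge_2 by (simp add: power_le_one_iff)
qed

lemma compact_unit_sphere: "compact unit_sphere"
proof -
  have box: "compact (PiE UNIV (\<lambda>v::'a. {-1..1::real}))"
    using compactin_PiE[of "\<lambda>_. euclidean" UNIV "\<lambda>v::'a. {-1..1::real}"]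
    by (simp add: euclidean_product_topology)
  have c1: "closed {x :: 'a \<Rightarrow> real. \<forall>v. v \<notin> V \<longrightarrow> x v = 0}"
    by (intro closed_Collect_all closed_Collect_imp open_Collect_const closed_Collect_eq
        continuous_on_product_coordinates continuous_on_const)
  have c2: "closed {x :: 'a \<Rightarrow> real. (\<Sum>v\<in>V. x v ^ k) = 1}"
    by (intro closed_Collect_eq continuous_intros continuous_on_product_coordinates)
  have "unit_sphere = PiE UNIV (\<lambda>v::'a. {-1..1::real}) \<inter>
      ({x. \<forall>v. v \<notin> V \<longrightarrow> x v = 0} \<inter> {x. (\<Sum>v\<in>V. x v ^ k) = 1})"
  proof (intro equalityI subsetI)
    fix x assume x: "x \<in> unit_sphere"
    have "x v \<in> {-1..1}" for v
      using x unit_sphere_abs_le_1[of x v] by (cases "v \<in> V") (auto simp: unit_sphere_def)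
    then show "x \<in> PiE UNIV (\<lambda>v::'a. {-1..1::real}) \<inter>
      ({x. \<forall>v. v \<notin> V \<longrightarrow> x v = 0} \<inter> {x. (\<Sum>v\<in>V. x v ^ k) = 1})"
      using x by (auto simp: unit_sphere_def)
  qed (auto simp: unit_sphere_def)
  then show ?thesis using compact_Int_closed[OF box closed_Int[OF c1 c2]] by simp
qed

lemma edge_form_cong: "(\<And>v. v \<in> V \<Longrightarrow> x v = y v) \<Longrightarrow> edge_form E x = edge_form E y"
  unfolding edge_form_def using edge_subset by (intro sum.cong prod.cong refl) blast

lemma edge_form_scale: "edge_form E (\<lambda>v. a * x v) = a ^ k * edge_form E x"
  unfolding edge_form_def sum_distrib_left
  by (intro sum.cong refl) (simp add: prod.distrib card_edge)

lemma normalised_in_unit_sphere: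
  assumes v: "v \<in> V" "x v \<noteq> 0"
  defines "s \<equiv> root k (\<Sum>v\<in>V. x v ^ k)"
  shows "s > 0" "s ^ k = (\<Sum>v\<in>V. x v ^ k)" "(\<lambda>v. if v \<in> V then x v / s else 0) \<in> unit_sphere"
proof -
  have "x v ^ k > 0" using v even_k by (simp add: zero_less_power_eq)
  then have pos: "(\<Sum>v\<in>V. x v ^ k) > 0"
    using finite_V v power_k_nonneg by (intro sum_pos2) auto
  show s: "s > 0" "s ^ k = (\<Sum>v\<in>V. x v ^ k)"
    unfolding s_def using pos k_ge_2 by auto
  have "(\<Sum>v\<in>V. (if v \<in> V then x v / s else 0) ^ k) = (\<Sum>v\<in>V. x v ^ k) / s ^ k"
    by (simp add: sum_divide_distrib power_divide)
  then show "(\<lambda>v. if v \<in> V then x v / s else 0) \<in> unit_sphere"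
    using s pos by (simp add: unit_sphere_def)
qed

lemma unit_sphere_nonempty: "unit_sphere \<noteq> {}"
  using normalised_in_unit_sphere(3)[of _ "\<lambda>_. 1"] V_nonempty by auto

lemma edge_form_eq_0:
  assumes "\<And>v. v \<in> V \<Longrightarrow> x v = 0" shows "edge_form E x = 0"
proof -
  have "edge_form E x = edge_form E (\<lambda>v. 0 * x v)" using assms by (intro edge_form_cong) simp
  then show ?thesis using k_ge_2 unfolding edge_form_scale by (simp add: power_0_left)
qed

text \<open>
  Both sides are homogeneous of degree \<open>k\<close>, so the minimum over the compact unit sphere gives an
  inequality for all vectors.
\<close>

lemma rayleigh_minimum_exists:
  obtains m x where "x \<in> unit_sphere" "m = real k * edge_form E x"
    "\<And>y. m * (\<Sum>v\<in>V. y v ^ k) \<le> real k * edge_form E y"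
proof -
  have "continuous_on unit_sphere (\<lambda>x. real k * edge_form E x)"
    unfolding edge_form_def
    by (intro continuous_intros continuous_on_subset[OF continuous_on_product_coordinates]) auto
  from continuous_attains_inf[OF compact_unit_sphere unit_sphere_nonempty this]
  obtain x where x: "x \<in> unit_sphere" "\<And>y. y \<in> unit_sphere \<Longrightarrow> real k * edge_form E x \<le> real k * edge_form E y"
    by auto
  define m where "m = real k * edge_form E x"
  have "m * (\<Sum>v\<in>V. y v ^ k) \<le> real k * edge_form E y" for y
  proof (cases "\<exists>v\<in>V. y v \<noteq> 0")
    case True
    then obtain v where v: "v \<in> V" "y v \<noteq> 0" by auto
    define s where "s = root k (\<Sum>v\<in>V. y v ^ k)"
    define z where "z = (\<lambda>v. if v \<in> V then y v / s else 0)"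
    note n = normalised_in_unit_sphere[of _ y, OF v, folded s_def, folded z_def]
    have "edge_form E z = edge_form E (\<lambda>v. (1 / s) * y v)"
      by (rule edge_form_cong) (simp add: z_def)
    then have "edge_form E z * s ^ k = edge_form E y"
      using n(1) unfolding edge_form_scale by (simp add: power_divide)
    moreover have "m * s ^ k \<le> real k * edge_form E z * s ^ k"
      using x(2)[OF n(3)] n(1) by (intro mult_right_mono) (auto simp: m_def)
    ultimately show ?thesis using n(2) by (simp add: mult.assoc)
  next
    case False
    then show ?thesis using edge_form_eq_0[of y] k_ge_2 by (simp add: power_0_left)
  qed
  with x(1) m_def that show thesis by blast
qed

lemma edge_form_fun_upd:
  "edge_form E (x(u := t)) =
     t * (\<Sum>e\<in>edges_at E u. \<Prod>w\<in>e - {u}. x w) + (\<Sum>e\<in>{e\<in>E. u \<notin> e}. \<Prod>w\<in>e. x w)"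
proof -
  have "edge_form E (x(u := t)) =
      (\<Sum>e\<in>edges_at E u. \<Prod>w\<in>e. (x(u := t)) w) + (\<Sum>e\<in>{e\<in>E. u \<notin> e}. \<Prod>w\<in>e. (x(u := t)) w)"
    unfolding edge_form_def edges_at_def using finite_E
    by (subst sum.union_disjoint[symmetric]) (auto intro!: sum.cong)
  also have "(\<Sum>e\<in>edges_at E u. \<Prod>w\<in>e. (x(u := t)) w) = (\<Sum>e\<in>edges_at E u. t * (\<Prod>w\<in>e - {u}. x w))"
  proof (intro sum.cong refl)
    fix e assume "e \<in> edges_at E u"
    then have "finite e" "u \<in> e" using finite_edge by (auto simp: edges_at_def)
    then have "(\<Prod>w\<in>e. (x(u := t)) w) = t * (\<Prod>w\<in>e - {u}. (x(u := t)) w)"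
      by (simp add: prod.remove[of e u])
    also have "(\<Prod>w\<in>e - {u}. (x(u := t)) w) = (\<Prod>w\<in>e - {u}. x w)"
      by (intro prod.cong) auto
    finally show "(\<Prod>w\<in>e. (x(u := t)) w) = t * (\<Prod>w\<in>e - {u}. x w)" .
  qed
  also have "(\<Sum>e\<in>{e\<in>E. u \<notin> e}. \<Prod>w\<in>e. (x(u := t)) w) = (\<Sum>e\<in>{e\<in>E. u \<notin> e}. \<Prod>w\<in>e. x w)"
    by (intro sum.cong prod.cong refl) auto
  finally show ?thesis by (simp only: sum_distrib_left)
qed

text \<open>
  The difference \<open>k * edge_form E y - m * (\<Sum>v\<in>V. y v ^ k)\<close> is nonnegative and vanishes at
  \<open>x\<close>. So its partial derivatives vanish at \<open>x\<close>, and up to a factor \<open>k\<close> these are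
  the eigenvalue equations.
\<close>

lemma rayleigh_minimiser_eigenpair:
  assumes x: "x \<in> unit_sphere" and m: "m = real k * edge_form E x"
    and min: "\<And>y. m * (\<Sum>v\<in>V. y v ^ k) \<le> real k * edge_form E y"
  shows "H_eigenpair k V E m x"
proof -
  have "\<exists>u\<in>V. x u \<noteq> 0"
  proof (rule ccontr)
    assume "\<not> (\<exists>u\<in>V. x u \<noteq> 0)"
    then have "(\<Sum>v\<in>V. x v ^ k) = 0" using k_ge_2 by (simp add: power_0_left)
    then show False using x by (simp add: unit_sphere_def)
  qed
  moreover have "m * x u ^ (k - 1) = (\<Sum>e\<in>edges_at E u. \<Prod>w\<in>e - {u}. x w)" if u: "u \<in> V" for u
  proof -
    define S where "S = (\<Sum>e\<in>edges_at E u. \<Prod>w\<in>e - {u}. x w)"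
    define C where "C = (\<Sum>e\<in>{e\<in>E. u \<notin> e}. \<Prod>w\<in>e. x w)"
    define D where "D = (\<Sum>v\<in>V - {u}. x v ^ k)"
    define g where "g = (\<lambda>t. real k * (t * S + C) - m * (t ^ k + D))"
    have form: "edge_form E (x(u := t)) = t * S + C" for t
      unfolding S_def C_def by (rule edge_form_fun_upd)
    have pow: "(\<Sum>v\<in>V. (x(u := t)) v ^ k) = t ^ k + D" for t
    proof -
      have "(\<Sum>v\<in>V. (x(u := t)) v ^ k) = t ^ k + (\<Sum>v\<in>V - {u}. (x(u := t)) v ^ k)"
        using finite_V u by (simp add: sum.remove[of V u])
      also have "(\<Sum>v\<in>V - {u}. (x(u := t)) v ^ k) = D"
        unfolding D_def by (intro sum.cong) auto
      finally show ?thesis .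
    qed
    have g0: "g t \<ge> 0" for t
      using min[of "x(u := t)"] unfolding form pow g_def by simp
    have gx: "g (x u) = 0"
      using form[of "x u"] pow[of "x u"] x m by (simp add: g_def unit_sphere_def)
    have der: "(g has_real_derivative (real k * S - m * (real k * x u ^ (k - 1)))) (at (x u))"
      unfolding g_def by (auto intro!: derivative_eq_intros)
    have "real k * S - m * (real k * x u ^ (k - 1)) = 0"
      by (rule DERIV_local_min[OF der zero_less_one]) (use g0 gx in auto)
    then have "real k * (m * x u ^ (k - 1)) = real k * S" by (simp only: mult.left_commute[of m] right_minus_eq)
    then show ?thesis using k_ge_2 unfolding S_def by auto
  qed
  ultimately show ?thesis by (simp add: H_eigenpair_def)
qed

abbreviation "least_ev \<equiv> least_H_eigenvalue k V E"

text \<open>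
  The minimum is an eigenvalue, and no eigenvalue lies below it, by \<open>eigenpair_rayleigh\<close>. So
  the least element in the definition of \<open>least_H_eigenvalue\<close> exists.
\<close>

lemma least_ev_variational:
  shows "\<exists>x\<in>unit_sphere. H_eigenpair k V E least_ev x"
    and "least_ev * (\<Sum>v\<in>V. y v ^ k) \<le> real k * edge_form E y"
proof -
  obtain m x where x: "x \<in> unit_sphere" "m = real k * edge_form E x"
    and min: "\<And>y. m * (\<Sum>v\<in>V. y v ^ k) \<le> real k * edge_form E y"
    by (rule rayleigh_minimum_exists) blast
  have ev: "H_eigenpair k V E m x" using x min by (rule rayleigh_minimiser_eigenpair)
  have "m \<le> \<mu>" if \<mu>: "H_eigenvalue k V E \<mu>" for \<mu>
  proof -
    obtain y where y: "H_eigenpair k V E \<mu> y" using \<mu> by (auto simp: H_eigenvalue_def)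
    then obtain v where v: "v \<in> V" "y v \<noteq> 0" by (auto simp: H_eigenpair_def)
    have "(\<Sum>v\<in>V. y v ^ k) > 0"
      using normalised_in_unit_sphere(1,2)[of _ y, OF v] by (metis zero_less_power)
    moreover have "m * (\<Sum>v\<in>V. y v ^ k) \<le> \<mu> * (\<Sum>v\<in>V. y v ^ k)"
      using min[of y] eigenpair_rayleigh[OF y] by simp
    ultimately show ?thesis by simp
  qed
  then have "least_ev = m"
    unfolding least_H_eigenvalue_def using ev
    by (intro Least_equality) (auto simp: H_eigenvalue_def)
  then show "\<exists>x\<in>unit_sphere. H_eigenpair k V E least_ev x"
    and "least_ev * (\<Sum>v\<in>V. y v ^ k) \<le> real k * edge_form E y"
    using ev x(1) min by auto
qed

text \<open>
  The vector with \<open>-1\<close> at \<open>i\<close>, \<open>1\<close> on the rest of \<open>U\<close> and \<open>0\<close> elsewhere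
  gives \<open>-1\<close> on each edge inside \<open>U\<close>, because these edges all contain \<open>i\<close>.
\<close>

lemma least_ev_test_vector:
  assumes U: "U \<subseteq> V" "i \<in> U" and S: "S = {e\<in>E. e \<subseteq> U}" "\<And>e. e \<in> S \<Longrightarrow> i \<in> e"
  shows "least_ev * real (card U) \<le> - real k * real (card S)"
proof -
  define y :: "'a \<Rightarrow> real" where "y = (\<lambda>v. if v = i then -1 else if v \<in> U then 1 else 0)"
  have "(\<Sum>v\<in>V. y v ^ k) = (\<Sum>v\<in>U. 1)"
    using U finite_V even_k k_ge_2
    by (intro sum.mono_neutral_cong_right) (auto simp: y_def power_0_left)
  moreover have "edge_form E y = (\<Sum>e\<in>S. -1)"
    unfolding edge_form_def
  proof (intro sum.mono_neutral_cong_right finite_E)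
    show "S \<subseteq> E" using S by auto
    show "\<forall>e\<in>E - S. (\<Prod>w\<in>e. y w) = 0"
    proof
      fix e assume e: "e \<in> E - S"
      then obtain w where "w \<in> e" "w \<notin> U" using S by auto
      then have "w \<in> e" "y w = 0" using U by (auto simp: y_def)
      then show "(\<Prod>w\<in>e. y w) = 0" using e finite_edge by (intro prod_zero) auto
    qed
    fix e assume e: "e \<in> S"
    then have f: "finite e" "i \<in> e" "e \<subseteq> U" using S finite_edge by auto
    then have "(\<Prod>w\<in>e. y w) = y i * (\<Prod>w\<in>e - {i}. y w)" by (simp add: prod.remove)
    also have "(\<Prod>w\<in>e - {i}. y w) = 1" using f by (intro prod.neutral) (auto simp: y_def)
    finally show "(\<Prod>w\<in>e. y w) = -1" by (simp add: y_def)
  qed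
  ultimately show ?thesis using least_ev_variational(2)[of y] by simp
qed

lemma least_ev_le_minus_one: "least_ev \<le> -1"
proof -
  obtain e where e: "e \<in> E" using E_nonempty by auto
  then obtain i where i: "i \<in> e" using card_edge k_ge_2 by fastforce
  have "{f\<in>E. f \<subseteq> e} = {e}"
    using e card_edge finite_edge by (auto dest: card_subset_eq)
  then have "least_ev * real k \<le> - real k * 1"
    using least_ev_test_vector[of e i "{e}"] e i edge_subset card_edge by auto
  then have "real k * least_ev \<le> real k * (-1)" by (simp add: mult.commute)
  then show ?thesis using k_ge_2 by (simp only: mult_le_cancel_left_pos of_nat_0_less_iff)
qed

section \<open>The largest component is attained\<close>

lemma least_eigenvector_iff:
  "least_eigenvector k V E x \<longleftrightarrow>
    (\<Sum>v\<in>V. x v ^ k) = 1 \<and>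
    (\<forall>u\<in>V. least_ev * x u ^ (k - 1) = (\<Sum>e\<in>edges_at E u. \<Prod>w\<in>e - {u}. x w))"
proof -
  have "\<exists>u\<in>V. x u \<noteq> 0" if "(\<Sum>v\<in>V. x v ^ k) = 1"
  proof (rule ccontr)
    assume "\<not> ?thesis"
    then have "(\<Sum>v\<in>V. x v ^ k) = 0" using k_ge_2 by (simp add: power_0_left)
    then show False using that by simp
  qed
  then show ?thesis
    by (auto simp: least_eigenvector_def H_eigenpair_def abs_power_k)
qed

lemma edge_minus_vertex: "e \<in> edges_at E u \<Longrightarrow> finite (e - {u}) \<and> card (e - {u}) = k - 1"
  using finite_edge card_edge by (auto simp: edges_at_def)

text \<open>Both sides of the eigenvalue equation have the odd degree \<open>k - 1\<close>.\<close>

lemma least_eigenvector_uminus: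
  assumes "least_eigenvector k V E x" shows "least_eigenvector k V E (\<lambda>v. - x v)"
proof -
  have odd: "(- a) ^ (k - 1) = - (a ^ (k - 1))" for a :: real
    using even_k k_ge_2 by (intro power_minus_odd) auto
  have "(\<Sum>e\<in>edges_at E u. \<Prod>w\<in>e - {u}. - x w) = - (\<Sum>e\<in>edges_at E u. \<Prod>w\<in>e - {u}. x w)" for u
    unfolding sum_negf[symmetric] using edge_minus_vertex
    by (intro sum.cong refl) (simp add: prod_uminus odd[of 1, simplified])
  then show ?thesis
    using assms even_k by (auto simp: least_eigenvector_iff odd simp del: One_nat_def)
qed

text \<open>
  The least eigenvectors supported on \<open>V\<close> form a compact set, so the set \<open>W\<close> of their
  components is compact and has a largest element; otherwise the value of \<open>GREATEST\<close> in
  \<open>c_max\<close> would be unspecified.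
\<close>

lemma c_max_ge:
  assumes x: "least_eigenvector k V E x" and v: "v \<in> V" shows "x v \<le> c_max k V E"
proof -
  define L where "L = unit_sphere \<inter> {x. \<forall>u. u \<in> V \<longrightarrow>
    least_ev * x u ^ (k - 1) = (\<Sum>e\<in>edges_at E u. \<Prod>w\<in>e - {u}. x w)}"
  define W where "W = (\<Union>v\<in>V. (\<lambda>x. x v) ` L)"
  have "compact L" unfolding L_def
    by (intro compact_Int_closed compact_unit_sphere closed_Collect_all closed_Collect_imp
        open_Collect_const closed_Collect_eq continuous_intros continuous_on_product_coordinates)
  then have cW: "compact W" unfolding W_def
    by (intro compact_UN finite_V compact_continuous_image
        continuous_on_subset[OF continuous_on_product_coordinates]) auto
  have W: "c \<in> W \<longleftrightarrow> (\<exists>x v. least_eigenvector k V E x \<and> v \<in> V \<and> c = x v)" for c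
  proof
    assume "c \<in> W"
    then show "\<exists>x v. least_eigenvector k V E x \<and> v \<in> V \<and> c = x v"
      by (auto simp: W_def L_def unit_sphere_def least_eigenvector_iff)
  next
    assume "\<exists>x v. least_eigenvector k V E x \<and> v \<in> V \<and> c = x v"
    then obtain x v where x: "least_eigenvector k V E x" "v \<in> V" "c = x v" by blast
    define y where "y = (\<lambda>v. if v \<in> V then x v else 0)"
    have "(\<Sum>e\<in>edges_at E u. \<Prod>w\<in>e - {u}. y w) = (\<Sum>e\<in>edges_at E u. \<Prod>w\<in>e - {u}. x w)" for u
      using edge_subset by (intro sum.cong prod.cong refl) (auto simp: y_def edges_at_def)
    then have "y \<in> L"
      using x by (auto simp: L_def unit_sphere_def least_eigenvector_iff y_def)
    then show "c \<in> W" unfolding W_def using x by (auto simp: y_def intro!: bexI[of _ v] image_eqI[of _ _ y])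
  qed
  have xW: "x v \<in> W" using W x v by blast
  then obtain s where s: "s \<in> W" "\<And>c. c \<in> W \<Longrightarrow> c \<le> s"
    using compact_attains_sup[OF cW] by auto
  have "c_max k V E = s"
    unfolding c_max_def W[symmetric] using s by (intro Greatest_equality) auto
  then show ?thesis using s(2)[OF xW] by simp
qed

lemma c_max_pos:
  assumes x: "least_eigenvector k V E x" shows "c_max k V E > 0"
proof -
  obtain v where v: "v \<in> V" "x v \<noteq> 0"
    using x by (auto simp: least_eigenvector_def H_eigenpair_def)
  have "x v \<le> c_max k V E" "- x v \<le> c_max k V E"
    using c_max_ge[OF x v(1)] c_max_ge[OF least_eigenvector_uminus[OF x] v(1)] by auto
  then show ?thesis using v(2) by linarith
qed

end
section \<open>The edges at a vertex\<close>

locale even_uniform_linear_hypergraph = even_uniform_hypergraph +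
  assumes linear: "linear_hypergraph E"
begin

lemma edges_at_Int:
  assumes "e \<in> edges_at E i" "f \<in> edges_at E i" "e \<noteq> f" shows "e \<inter> f = {i}"
proof -
  have "card (e \<inter> f) \<le> 1" "i \<in> e \<inter> f" "finite (e \<inter> f)"
    using assms linear finite_edge by (auto simp: linear_hypergraph_def edges_at_def)
  then show ?thesis using card_le_Suc0_iff_eq[of "e \<inter> f"] by auto
qed

lemma sum_star_eq_sum_neighbours:
  "(\<Sum>e\<in>edges_at E i. \<Sum>w\<in>e - {i}. g w) = (\<Sum>j\<in>{j\<in>V. adjacent E j i}. g j)"
proof -
  have nbrs: "{j\<in>V. adjacent E j i} = (\<Union>e\<in>edges_at E i. e - {i})"
    using edge_subset by (auto simp: adjacent_def edges_at_def)
  have "\<forall>e\<in>edges_at E i. \<forall>f\<in>edges_at E i. e \<noteq> f \<longrightarrow> (e - {i}) \<inter> (f - {i}) = {}"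
    using edges_at_Int by blast
  then show ?thesis
    unfolding nbrs using edge_minus_vertex
    by (intro sum.UNION_disjoint[symmetric] finite_edges_at ballI) blast+
qed

text \<open>
  The degree of a vertex whose edges cover \<open>V\<close>.
\<close>

definition star_size :: real where "star_size = (real (card V) - 1) / (real k - 1)"

lemma degree_le:
  assumes i: "i \<in> V"
  shows "real (vertex_degree E i) \<le> star_size"
proof -
  have "vertex_degree E i * (k - 1) = (\<Sum>e\<in>edges_at E i. \<Sum>w\<in>e - {i}. 1)"
    using edge_minus_vertex by (simp add: vertex_degree_def)
  also have "\<dots> = card {j\<in>V. adjacent E j i}"
    unfolding sum_star_eq_sum_neighbours by simp
  also have "\<dots> \<le> card (V - {i})"
    using finite_V by (intro card_mono) (auto simp: adjacent_def)
  also have "\<dots> = card V - 1" using i finite_V by simp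
  finally have "real (vertex_degree E i) * real (k - 1) \<le> real (card V - 1)"
    by (metis of_nat_le_iff of_nat_mult)
  moreover have "card V \<ge> 1" using i finite_V by (metis One_nat_def Suc_leI card_gt_0_iff empty_iff)
  ultimately show ?thesis using k_ge_2 by (simp add: star_size_def of_nat_diff field_simps)
qed

lemma star_size_ge_1: "star_size \<ge> 1"
proof -
  obtain e where e: "e \<in> E" using E_nonempty by auto
  have "k \<le> card V" using card_mono[OF finite_V edge_subset[OF e]] card_edge[OF e] by simp
  then show ?thesis using k_ge_2 by (simp add: star_size_def)
qed

text \<open>
  In the extremal situation this is the ratio \<open>x i / \<bar>x j\<bar>\<close> for \<open>j\<close> adjacent to
  \<open>i\<close>: with \<open>star_size\<close> edges at \<open>i\<close>, eigenvalue \<open>-1\<close> and equal absolute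
  values at all neighbours, the eigenvalue equation at \<open>i\<close> says that its \<open>(k - 1)\<close>-st power
  is \<open>star_size\<close>.
\<close>

definition star_ratio :: real where "star_ratio = star_size powr (1 / (real k - 1))"

lemma star_ratio_ge_1: "star_ratio \<ge> 1"
  unfolding star_ratio_def using star_size_ge_1 k_ge_2 by (intro ge_one_powr_ge_zero) auto

lemma star_ratio_le_star_size: "star_ratio \<le> star_size"
proof -
  have "star_ratio \<le> star_size powr 1" unfolding star_ratio_def using star_size_ge_1 k_ge_2 by (intro powr_mono) auto
  then show ?thesis using star_size_ge_1 by simp
qed

lemma star_ratio_power_k: "star_ratio ^ k = star_size powr (real k / (real k - 1))"
proof -
  have "star_ratio ^ k = star_ratio powr real k" using star_ratio_ge_1 by (simp add: powr_realpow)
  then show ?thesis by (simp add: star_ratio_def powr_powr)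
qed

lemma star_ratio_power_k_minus_1: "star_ratio ^ (k - 1) = star_size"
proof -
  have "star_ratio ^ (k - 1) = star_ratio powr (real (k - 1))" using star_ratio_ge_1 by (simp add: powr_realpow)
  also have "\<dots> = star_size powr (1 / (real k - 1) * (real k - 1))"
    using k_ge_2 by (simp add: star_ratio_def powr_powr of_nat_diff)
  also have "\<dots> = star_size" using k_ge_2 star_size_ge_1 by simp
  finally show ?thesis .
qed

text \<open>
  The difference of the two sides is a sum of five nonnegative terms. Up to a positive factor, each measures the loss in one
  estimate: \<open>s1\<close> in \<open>least_ev \<le> -1\<close>, \<open>s2\<close> in the triangle inequality for the
  eigenvalue equation at \<open>i\<close>, \<open>s3\<close> in the inequality of arithmetic and geometric means on
  the edges at \<open>i\<close>, \<open>s4\<close> in dropping the vertices not adjacent to \<open>i\<close> from the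
  norm, and \<open>s5\<close> in the degree bound. So in the case of equality every estimate is sharp.
\<close>

lemma star_inequality:
  assumes x: "least_eigenvector k V E x" and i: "i \<in> V" and c: "x i > 0"
  shows "x i ^ k * (1 + (real k - 1) / star_ratio) \<le> 1"
    and "x i ^ k * (1 + (real k - 1) / star_ratio) = 1 \<Longrightarrow> least_ev = -1"
    and "x i ^ k * (1 + (real k - 1) / star_ratio) = 1 \<Longrightarrow> real (vertex_degree E i) = star_size"
    and "x i ^ k * (1 + (real k - 1) / star_ratio) = 1 \<Longrightarrow> j \<in> V - {i} \<Longrightarrow> \<not> adjacent E j i \<Longrightarrow> x j = 0"
    and "x i ^ k * (1 + (real k - 1) / star_ratio) = 1 \<Longrightarrow> adjacent E j i \<Longrightarrow> \<bar>x j\<bar> = x i / star_ratio"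
    and "x i ^ k * (1 + (real k - 1) / star_ratio) = 1 \<Longrightarrow> e \<in> edges_at E i \<Longrightarrow> (\<Prod>w\<in>e - {i}. x w) < 0"
proof -
  define t where "t = x i / star_ratio"
  define P where "P e = (\<Prod>w\<in>e - {i}. x w)" for e
  define d where "d = real (vertex_degree E i)"
  define nbr where "nbr = {j\<in>V. adjacent E j i}"
  define s1 where "s1 = real k * t * ((- least_ev - 1) * x i ^ (k - 1))"
  define s2 where "s2 = (\<Sum>e\<in>edges_at E i. \<bar>P e\<bar> + P e)"
  define a where "a e = (\<Sum>w\<in>e - {i}. \<bar>x w\<bar> ^ k) + t ^ k - real k * t * \<bar>P e\<bar>" for e
  define s3 where "s3 = (\<Sum>e\<in>edges_at E i. a e)"
  define s4 where "s4 = (\<Sum>j\<in>V - {i} - nbr. x j ^ k)"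
  define s5 where "s5 = (star_size - d) * t ^ k"
  have t: "t > 0" unfolding t_def using c star_ratio_ge_1 by simp
  have absP: "\<bar>P e\<bar> = (\<Prod>w\<in>e - {i}. \<bar>x w\<bar>)" for e unfolding P_def by (rule abs_prod)
  have fin: "finite (e - {i})" if "e \<in> edges_at E i" for e
    using edge_minus_vertex[OF that] by simp
  have kcard: "k = card (e - {i}) + 1" if "e \<in> edges_at E i" for e
    using edge_minus_vertex[OF that] k_ge_2 by simp
  have a0: "a e \<ge> 0" if e: "e \<in> edges_at E i" for e
    using amgm_with_parameter(1)[OF fin[OF e] abs_ge_zero kcard[OF e] t, of x]
    unfolding a_def absP by simp
  have s1: "s1 \<ge> 0" unfolding s1_def using t c least_ev_le_minus_one
    by (intro mult_nonneg_nonneg) auto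
  have s2: "s2 \<ge> 0" unfolding s2_def by (intro sum_nonneg) auto
  have s3: "s3 \<ge> 0" unfolding s3_def using a0 by (intro sum_nonneg) auto
  have s4: "s4 \<ge> 0" unfolding s4_def using power_k_nonneg by (intro sum_nonneg) auto
  have s5: "s5 \<ge> 0" unfolding s5_def using degree_le[OF i] t by (simp add: d_def)
  have eigen: "(\<Sum>e\<in>edges_at E i. P e) = least_ev * x i ^ (k - 1)"
    using x i by (simp add: least_eigenvector_iff P_def)
  have total: "1 = x i ^ k + (\<Sum>j\<in>nbr. x j ^ k) + s4"
  proof -
    have "1 = x i ^ k + (\<Sum>j\<in>V - {i}. x j ^ k)"
      using x i finite_V by (simp add: least_eigenvector_iff sum.remove)
    also have "(\<Sum>j\<in>V - {i}. x j ^ k) = s4 + (\<Sum>j\<in>nbr. x j ^ k)"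
      unfolding s4_def using finite_V by (intro sum.subset_diff) (auto simp: nbr_def adjacent_def)
    finally show ?thesis by simp
  qed
  have s3_eq: "s3 = (\<Sum>j\<in>nbr. x j ^ k) + d * t ^ k - real k * t * (\<Sum>e\<in>edges_at E i. \<bar>P e\<bar>)"
    unfolding s3_def a_def abs_power_k
    by (simp add: sum_subtractf sum.distrib sum_star_eq_sum_neighbours nbr_def d_def
        vertex_degree_def sum_distrib_left)
  have s2_eq: "s2 = (\<Sum>e\<in>edges_at E i. \<bar>P e\<bar>) + least_ev * x i ^ (k - 1)"
    unfolding s2_def by (simp add: sum.distrib eigen)
  have pow: "x i * x i ^ (k - 1) = x i ^ k" "star_ratio * star_ratio ^ (k - 1) = star_ratio ^ k"
    using k_ge_2 by (simp_all add: power_eq_if)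
  have tc: "t * x i ^ (k - 1) = x i ^ k / star_ratio" using pow by (simp add: t_def)
  have tk: "star_size * t ^ k = x i ^ k / star_ratio"
    unfolding t_def power_divide pow(2)[symmetric] star_ratio_power_k_minus_1 using star_size_ge_1 by simp
  \<comment> \<open>The terms in \<open>least_ev\<close>, in the degree and in the \<open>\<bar>P e\<bar>\<close> cancel.\<close>
  have slack: "s1 + real k * t * s2 + s3 + s4 + s5 = 1 - x i ^ k * (1 + (real k - 1) / star_ratio)"
  proof -
    have "s1 + real k * t * s2 + s3 + s4 + s5 =
        (\<Sum>j\<in>nbr. x j ^ k) + s4 + star_size * t ^ k - real k * (t * x i ^ (k - 1))"
      unfolding s1_def s2_eq s3_eq s5_def by (simp add: algebra_simps)
    also have "\<dots> = 1 - x i ^ k + x i ^ k / star_ratio - real k * (x i ^ k / star_ratio)"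
      unfolding tc tk using total by simp
    also have "\<dots> = 1 - x i ^ k * (1 + (real k - 1) / star_ratio)"
      using star_ratio_ge_1 by (simp add: field_simps)
    finally show ?thesis .
  qed
  have kt: "real k * t > 0" using t k_ge_2 by simp
  have kts2: "real k * t * s2 \<ge> 0" using kt s2 by (intro mult_nonneg_nonneg[OF less_imp_le])
  show "x i ^ k * (1 + (real k - 1) / star_ratio) \<le> 1" using slack s1 kts2 s3 s4 s5 by linarith
  assume eq: "x i ^ k * (1 + (real k - 1) / star_ratio) = 1"
  have z: "s1 = 0" "real k * t * s2 = 0" "s3 = 0" "s4 = 0" "s5 = 0"
    using slack s1 kts2 s3 s4 s5 eq by linarith+
  show lam: "least_ev = -1" using z(1) t c k_ge_2 by (simp add: s1_def)
  show "real (vertex_degree E i) = star_size" using z(5) t by (simp add: s5_def d_def)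
  show "x j = 0" if "j \<in> V - {i}" "\<not> adjacent E j i"
  proof -
    have "\<forall>j\<in>V - {i} - nbr. x j ^ k = 0"
      using z(4) finite_V power_k_nonneg unfolding s4_def by (subst (asm) sum_nonneg_eq_0_iff) auto
    then show ?thesis using that by (auto simp: nbr_def)
  qed
  have star: "\<bar>x w\<bar> = t" if e: "e \<in> edges_at E i" and w: "w \<in> e - {i}" for e w
  proof -
    have "a e = 0" using z(3) a0 finite_edges_at e unfolding s3_def
      by (subst (asm) sum_nonneg_eq_0_iff) auto
    then show ?thesis
      using amgm_with_parameter(2)[OF fin[OF e] abs_ge_zero kcard[OF e] t _ w, of x]
      unfolding a_def absP by simp
  qed
  show "\<bar>x j\<bar> = x i / star_ratio" if "adjacent E j i"
    using that star[of _ j] by (auto simp: adjacent_def edges_at_def t_def)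
  show "(\<Prod>w\<in>e - {i}. x w) < 0" if e: "e \<in> edges_at E i"
  proof -
    have "\<bar>P e\<bar> + P e = 0"
      using z(2) t k_ge_2 finite_edges_at e unfolding s2_def by (auto simp: sum_nonneg_eq_0_iff)
    moreover have "\<bar>P e\<bar> > 0" unfolding absP using star[OF e] t by (intro prod_pos) auto
    ultimately show ?thesis by (simp add: P_def)
  qed
qed

text \<open>
  A further edge meets each of the two edges in at most one vertex, so it has too few vertices to lie
  in their union. The test vector on the union, which has \<open>2 * k - 1\<close> vertices, then yields
  \<open>least_ev \<le> - 2 * k / (2 * k - 1)\<close>. For \<open>k = 2\<close> the third edge of a triangle would
  spoil this; indeed complete graphs have least eigenvalue \<open>-1\<close>.
\<close>

lemma least_ev_less_if_two_edges_at_vertex: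
  assumes k: "k > 2" and i: "vertex_degree E i \<ge> 2"
  shows "least_ev < -1"
proof -
  obtain e f where ef: "e \<in> edges_at E i" "f \<in> edges_at E i" "e \<noteq> f"
    using i unfolding vertex_degree_def by (metis card_le_Suc0_iff_eq finite_edges_at not_less_eq_eq numeral_2_eq_2)
  have E: "e \<in> E" "f \<in> E" "i \<in> e" "i \<in> f" using ef by (auto simp: edges_at_def)
  have cU: "card (e \<union> f) = 2 * k - 1"
    using card_Un_Int[of e f] edges_at_Int[OF ef] finite_edge card_edge E by simp
  have S: "{g\<in>E. g \<subseteq> e \<union> f} = {e, f}"
  proof -
    have "g = e \<or> g = f" if g: "g \<in> E" "g \<subseteq> e \<union> f" for g
    proof (rule ccontr)
      assume "\<not> ?thesis"
      then have "card (g \<inter> e) \<le> 1" "card (g \<inter> f) \<le> 1"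
        using linear g E by (auto simp: linear_hypergraph_def)
      moreover have "card g \<le> card (g \<inter> e) + card (g \<inter> f)"
        using g(2) card_Un_le[of "g \<inter> e" "g \<inter> f"] by (simp add: Int_Un_distrib[symmetric] Int_absorb2)
      ultimately show False using card_edge[OF g(1)] k by simp
    qed
    then show ?thesis using E by auto
  qed
  have "least_ev * real (2 * k - 1) \<le> - real k * 2"
    using least_ev_test_vector[of "e \<union> f" i "{e, f}"] E S edge_subset cU ef(3) by auto
  moreover have "real (2 * k - 1) = 2 * real k - 1" using k by (simp add: of_nat_diff)
  moreover have "least_ev * (2 * real k - 1) \<ge> (-1) * (2 * real k - 1)" if "least_ev \<ge> -1"
    using that k by (intro mult_right_mono) auto
  ultimately show ?thesis using k by fastforce
qed

text \<open>
  The sum of the \<open>k\<close>-th powers yields the equation with \<open>star_ratio\<close> in place of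
  \<open>star_size\<close>. The two numbers agree for \<open>k = 2\<close> by definition, and for \<open>k > 2\<close>
  both are \<open>1\<close> because \<open>least_ev = -1\<close> allows only one edge at \<open>i\<close>.
\<close>

lemma star_equality_converse:
  assumes x: "least_eigenvector k V E x" and i: "i \<in> V" and c: "x i > 0"
    and adj: "\<And>j. j \<in> V - {i} \<Longrightarrow> adjacent E j i \<Longrightarrow> x j ^ k = x i ^ k / star_ratio ^ k"
    and nonadj: "\<And>j. j \<in> V - {i} \<Longrightarrow> \<not> adjacent E j i \<Longrightarrow> x j = 0"
    and lam: "least_ev = -1"
  shows "x i ^ k * (1 + (real k - 1) / star_size) = 1"
proof -
  define d where "d = real (vertex_degree E i)"
  have star: "\<bar>x w\<bar> = x i / star_ratio" if "e \<in> edges_at E i" "w \<in> e - {i}" for e w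
  proof -
    have "w \<in> V - {i}" "adjacent E w i" using that edge_subset by (auto simp: edges_at_def adjacent_def)
    then have "\<bar>x w\<bar> ^ k = (x i / star_ratio) ^ k" using adj by (simp add: abs_power_k power_divide)
    then show ?thesis using c star_ratio_ge_1 k_ge_2 by (auto intro: power_eq_imp_eq_base[of _ k])
  qed
  \<comment> \<open>With fewer than \<open>star_size\<close> edges the products at \<open>i\<close> could not add up to \<open>- (x i ^ (k - 1))\<close>.\<close>
  have "(\<Sum>e\<in>edges_at E i. \<Prod>w\<in>e - {i}. x w) = - (x i ^ (k - 1))"
    using x i lam by (simp add: least_eigenvector_iff)
  then have "x i ^ (k - 1) = \<bar>\<Sum>e\<in>edges_at E i. \<Prod>w\<in>e - {i}. x w\<bar>"
    using c by simp
  also have "\<dots> \<le> (\<Sum>e\<in>edges_at E i. \<bar>\<Prod>w\<in>e - {i}. x w\<bar>)" by (rule sum_abs)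
  also have "\<dots> = (\<Sum>e\<in>edges_at E i. (x i / star_ratio) ^ (k - 1))"
    using star edge_minus_vertex by (intro sum.cong refl) (simp add: abs_prod)
  also have "\<dots> = x i ^ (k - 1) * (d / star_size)"
    by (simp add: d_def vertex_degree_def power_divide star_ratio_power_k_minus_1 del: One_nat_def)
  finally have "x i ^ (k - 1) * 1 \<le> x i ^ (k - 1) * (d / star_size)" by simp
  then have "1 \<le> d / star_size" using c by (simp only: mult_le_cancel_left_pos zero_less_power)
  then have "star_size \<le> d" using star_size_ge_1 by (simp add: field_simps)
  moreover have "d \<le> star_size" unfolding d_def by (rule degree_le[OF i])
  ultimately have dN: "d = star_size" by simp
  have qN: "star_ratio = star_size"
  proof (cases "k = 2")
    case True
    then show ?thesis using star_ratio_power_k_minus_1 by simp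
  next
    case False
    then have "\<not> vertex_degree E i \<ge> 2" using least_ev_less_if_two_edges_at_vertex[of i] lam k_ge_2 by linarith
    then have "star_size = 1" using dN star_size_ge_1 by (simp add: d_def)
    then show ?thesis by (simp add: star_ratio_def)
  qed
  have "1 = x i ^ k + (\<Sum>j\<in>V - {i}. x j ^ k)"
    using x i finite_V by (simp add: least_eigenvector_iff sum.remove)
  also have "(\<Sum>j\<in>V - {i}. x j ^ k) = (\<Sum>j\<in>{j\<in>V. adjacent E j i}. x j ^ k)"
    using finite_V nonadj k_ge_2 by (intro sum.mono_neutral_right) (auto simp: adjacent_def power_0_left)
  also have "\<dots> = (\<Sum>e\<in>edges_at E i. \<Sum>w\<in>e - {i}. x w ^ k)"
    by (rule sum_star_eq_sum_neighbours[symmetric])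
  also have "\<dots> = (\<Sum>e\<in>edges_at E i. \<Sum>w\<in>e - {i}. (x i / star_ratio) ^ k)"
    using star by (intro sum.cong refl) (metis abs_power_k)
  also have "\<dots> = d * (real k - 1) * (x i / star_ratio) ^ k"
    using edge_minus_vertex k_ge_2 by (simp add: d_def vertex_degree_def of_nat_diff)
  also have "(x i / star_ratio) ^ k = x i ^ k / (star_ratio * star_size)"
    using k_ge_2 star_ratio_power_k_minus_1 by (simp add: power_divide power_eq_if[of star_ratio k])
  also have "d * (real k - 1) * (x i ^ k / (star_ratio * star_size)) = x i ^ k * ((real k - 1) / star_size)"
    unfolding dN qN using star_size_ge_1 by simp
  finally show ?thesis by (simp add: distrib_left)
qed

end

section \<open>The bound on the largest component\<close>

theorem theorem5p4:
  fixes n k i :: nat and E :: "nat set set" and x :: "nat \<Rightarrow> real"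
  assumes "n \<ge> 2" and "k \<ge> 2" and "even k"
    and "uniform_hypergraph k {1..n} E" and "linear_hypergraph E" and "E \<noteq> {}"
    and "least_eigenvector k {1..n} E x" and "i \<in> {1..n}"
    and "x i = c_max k {1..n} E"
  shows "c_max k {1..n} E \<le> root k ((real n - 1) / (real n - 1 + (real k - 1)\<^sup>2)) \<and>
    (c_max k {1..n} E = root k ((real n - 1) / (real n - 1 + (real k - 1)\<^sup>2)) \<longleftrightarrow>
      (\<forall>j\<in>{1..n} - {i}.
         (adjacent E j i \<longrightarrow>
            x j ^ k = x i ^ k / ((real n - 1) / (real k - 1)) powr (real k / (real k - 1))) \<and>
         (\<not> adjacent E j i \<longrightarrow> x j = 0)) \<and>
      least_H_eigenvalue k {1..n} E = -1 \<and>
      real (max_degree {1..n} E) = (real n - 1) / (real k - 1) \<and>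
      (\<forall>e\<in>edges_at E i. \<forall>f\<in>edges_at E i.
         sgn (\<Prod>w\<in>e - {i}. x w) = sgn (\<Prod>w\<in>f - {i}. x w)))"
proof -
  interpret even_uniform_linear_hypergraph k "{1..n}" E
    using assms by unfold_locales
  define B where "B = (real n - 1) / (real n - 1 + (real k - 1)\<^sup>2)"
  have star_size_eq: "star_size = (real n - 1) / (real k - 1)" unfolding star_size_def by simp
  have B_eq: "B = 1 / (1 + (real k - 1) / star_size)"
    using assms(1,2) unfolding B_def star_size_eq by (simp add: field_simps power2_eq_square)
  have M0: "1 + (real k - 1) / star_size > 0" using assms(2) star_size_ge_1 by (intro add_pos_nonneg) auto
  have B0: "B > 0" using M0 B_eq by simp
  have c: "x i > 0" using c_max_pos[OF assms(7)] assms(9) by simp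
  have le_q: "x i ^ k * (1 + (real k - 1) / star_size) \<le> x i ^ k * (1 + (real k - 1) / star_ratio)"
    using star_ratio_le_star_size star_ratio_ge_1 star_size_ge_1 assms(2) c by (intro mult_left_mono add_left_mono divide_left_mono) auto
  note star = star_inequality[OF assms(7,8) c]
  have le: "x i ^ k \<le> B"
    using le_q star(1) M0 unfolding B_eq by (simp add: pos_le_divide_eq)
  have root_pos: "root k B > 0" using B0 assms(2) by simp
  have root_pow: "root k B ^ k = B" using B0 assms(2) by simp
  have bound: "x i \<le> root k B"
    using le root_pow c assms(2) root_pos power_mono_iff[of "x i" "root k B" k] by simp
  have root_iff: "x i = root k B \<longleftrightarrow> x i ^ k * (1 + (real k - 1) / star_size) = 1"
  proof -
    have "x i = root k B \<longleftrightarrow> x i ^ k = B"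
      using root_pow c assms(2) root_pos power_eq_iff_eq_base[of k "x i" "root k B"] by simp
    also have "\<dots> \<longleftrightarrow> x i ^ k * (1 + (real k - 1) / star_size) = 1"
      using M0 unfolding B_eq by (simp add: eq_divide_eq)
    finally show ?thesis .
  qed
  have tight_iff: "x i ^ k * (1 + (real k - 1) / star_size) = 1 \<longleftrightarrow>
      (\<forall>j\<in>{1..n} - {i}. (adjacent E j i \<longrightarrow> x j ^ k = x i ^ k / star_ratio ^ k) \<and>
         (\<not> adjacent E j i \<longrightarrow> x j = 0)) \<and>
      least_ev = -1 \<and> real (max_degree {1..n} E) = star_size \<and>
      (\<forall>e\<in>edges_at E i. \<forall>f\<in>edges_at E i.
         sgn (\<Prod>w\<in>e - {i}. x w) = sgn (\<Prod>w\<in>f - {i}. x w))" (is "?eq \<longleftrightarrow> ?C")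
  proof
    assume ?eq
    then have tight: "x i ^ k * (1 + (real k - 1) / star_ratio) = 1" using le_q star(1) by linarith
    have max: "real (max_degree {1..n} E) = star_size"
    proof -
      have "max_degree {1..n} E \<in> vertex_degree E ` {1..n}"
        unfolding max_degree_def using assms(8) by (intro Max_in) auto
      then obtain j where j: "j \<in> {1..n}" "max_degree {1..n} E = vertex_degree E j" by blast
      have "real (max_degree {1..n} E) \<le> star_size" unfolding j(2) by (rule degree_le[OF j(1)])
      moreover have "vertex_degree E i \<le> max_degree {1..n} E"
        unfolding max_degree_def by (rule Max_ge) (use assms(8) in blast)+
      ultimately show ?thesis using star(3)[OF tight] by linarith
    qed
    have nbr: "x j ^ k = x i ^ k / star_ratio ^ k" if "adjacent E j i" for j
      using star(5)[OF tight that] abs_power_k[of "x j"] by (simp add: power_divide)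
    have sign: "sgn (\<Prod>w\<in>e - {i}. x w) = -1" if "e \<in> edges_at E i" for e
      using star(6)[OF tight that] by simp
    show ?C using nbr star(2,4)[OF tight] max by (intro conjI ballI impI) (auto simp: sign)
  next
    assume ?C
    then show ?eq using assms(7,8) c by (intro star_equality_converse) auto
  qed
  show ?thesis
    using bound trans[OF root_iff tight_iff]
    unfolding assms(9)[symmetric] B_def star_size_eq[symmetric] star_ratio_power_k by (rule conjI)
qed

end
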